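(* Let $a>b>0$, and consider the family of all triangles inscribed in the ellipse $\frac{x^2}{a^2}+\frac{y^2}{b^2}=1$ and circumscribed about the ellipse (caustic) $\frac{x^2}{(a/2)^2}+\frac{y^2}{(b/2)^2}=1$ (the 3-periodics of the homothetic pair). Over this family, the locus of the vertices of the First Brocard Triangle $T_1$ is an axis-aligned ellipse centered at the origin, homothetic to the ellipses in the pair and interior to the caustic, with semi-axes $$a'=\frac{a(a^2-b^2)}{2(a^2+b^2)},\qquad b'=\frac{b(a^2-b^2)}{2(a^2+b^2)}$$ along the $x$- and $y$-axes respectively.
   Context: The two concentric, axis-aligned ellipses with semi-axes $(a,b)$ and $(a/2,b/2)$ form a Poncelet pair: every point of the outer ellipse is a vertex of a triangle inscribed in the outer ellipse whose three sides are tangent to the inner one. Brocard points of a triangle $P_1P_2P_3$: $\Omega_1$ is the unique interior point with $\angle\Omega_1P_1P_2=\angle\Omega_1P_2P_3=\angle\Omega_1P_3P_1$; $\Omega_2$ is the unique interior point with $\angle\Omega_2P_2P_1=\angle\Omega_2P_3P_2=\angle\Omega_2P_1P_3$. First Brocard Triangle $T_1=P_1'P_2'P_3'$ of $P_1P_2P_3$: $P_1'$ is the intersection of the lines $P_2\Omega_1$ and $P_3\Omega_2$; $P_2'$ is the intersection of $P_3\Omega_1$ and $P_1\Omega_2$; $P_3'$ is the intersection of $P_1\Omega_1$ and $P_2\Omega_2$. *)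

theory Defs
  imports "HOL-Analysis.Analysis"
begin

definition ellipse :: "real \<Rightarrow> real \<Rightarrow> (real^2) set" where
  "ellipse p q = {X. (X $ 1)\<^sup>2 / p\<^sup>2 + (X $ 2)\<^sup>2 / q\<^sup>2 = 1}"

definition homothetic :: "(real^2) set \<Rightarrow> (real^2) set \<Rightarrow> bool" where
  "homothetic S T \<longleftrightarrow> (\<exists>c k. k \<noteq> 0 \<and> S = (\<lambda>X. c + k *\<^sub>R (X - c)) ` T)"

text \<open>The unoriented angle at \<open>B\<close>, in \<open>[0, pi]\<close>; meaningful for \<open>A \<noteq> B\<close> and \<open>C \<noteq> B\<close>.\<close>

definition angle :: "real^2 \<Rightarrow> real^2 \<Rightarrow> real^2 \<Rightarrow> real" where
  "angle A B C = arccos (((A - B) \<bullet> (C - B)) / (norm (A - B) * norm (C - B)))"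

text \<open>The line through \<open>A \<noteq> B\<close> is \<open>affine hull {A, B}\<close>. A line is tangent to an ellipse iff it
  meets it in exactly one point.\<close>

definition tangent_line :: "real^2 \<Rightarrow> real^2 \<Rightarrow> (real^2) set \<Rightarrow> bool" where
  "tangent_line A B E \<longleftrightarrow> A \<noteq> B \<and> (\<exists>X. affine hull {A, B} \<inter> E = {X})"

definition lines_meet :: "real^2 \<Rightarrow> real^2 \<Rightarrow> real^2 \<Rightarrow> real^2 \<Rightarrow> real^2" where
  "lines_meet A B C D = (THE X. affine hull {A, B} \<inter> affine hull {C, D} = {X})"

definition inscribed_triangle :: "real^2 \<Rightarrow> real^2 \<Rightarrow> real^2 \<Rightarrow> (real^2) set \<Rightarrow> bool" where
  "inscribed_triangle P1 P2 P3 E \<longleftrightarrow> \<not> collinear {P1, P2, P3} \<and> {P1, P2, P3} \<subseteq> E"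

definition circumscribed_triangle :: "real^2 \<Rightarrow> real^2 \<Rightarrow> real^2 \<Rightarrow> (real^2) set \<Rightarrow> bool" where
  "circumscribed_triangle P1 P2 P3 E \<longleftrightarrow> \<not> collinear {P1, P2, P3} \<and>
     tangent_line P1 P2 E \<and> tangent_line P2 P3 E \<and> tangent_line P3 P1 E"

definition brocard_point1 :: "real^2 \<Rightarrow> real^2 \<Rightarrow> real^2 \<Rightarrow> real^2" where
  "brocard_point1 P1 P2 P3 = (THE W. W \<in> interior (convex hull {P1, P2, P3}) \<and>
     angle W P1 P2 = angle W P2 P3 \<and> angle W P2 P3 = angle W P3 P1)"

definition brocard_point2 :: "real^2 \<Rightarrow> real^2 \<Rightarrow> real^2 \<Rightarrow> real^2" where
  "brocard_point2 P1 P2 P3 = (THE W. W \<in> interior (convex hull {P1, P2, P3}) \<and>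
     angle W P2 P1 = angle W P3 P2 \<and> angle W P3 P2 = angle W P1 P3)"

definition first_brocard_triangle_vertices :: "real^2 \<Rightarrow> real^2 \<Rightarrow> real^2 \<Rightarrow> (real^2) set" where
  "first_brocard_triangle_vertices P1 P2 P3 =
     (let W1 = brocard_point1 P1 P2 P3; W2 = brocard_point2 P1 P2 P3
      in {lines_meet P2 W1 P3 W2, lines_meet P3 W1 P1 W2, lines_meet P1 W1 P2 W2})"

definition first_brocard_locus :: "(real^2) set \<Rightarrow> (real^2) set \<Rightarrow> (real^2) set" where
  "first_brocard_locus E C =
     \<Union> {first_brocard_triangle_vertices P1 P2 P3 | P1 P2 P3.
         inscribed_triangle P1 P2 P3 E \<and> circumscribed_triangle P1 P2 P3 C}"

end

theory Submission
  imports Defs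
begin

text \<open>Why the theorem holds. The map \<open>(x, y) \<mapsto> (a x, b y)\<close> carries the unit circle to the outer
  ellipse and the circle of radius \<open>1/2\<close> to the caustic. A chord of the unit circle touches
  the smaller circle exactly when it subtends \<open>120\<close> degrees at the centre
  (\<open>tangent_chord_iff\<close>), so the triangles of the family are precisely the affine images of the
  equilateral triangles inscribed in the unit circle (\<open>poncelet_triangleE\<close>,
  \<open>poncelet_triangle_exists\<close>).

  For an arbitrary triangle \<open>P Q R\<close> put \<open>A = QR\<^sup>2\<close>, \<open>B = RP\<^sup>2\<close>, \<open>C = PQ\<^sup>2\<close>. The first Brocard point
  has barycentric coordinates \<open>1/B : 1/C : 1/A\<close> (\<open>brocard_point1_eq_bary\<close>), and exchanging
  two labels gives the second one as \<open>1/C : 1/A : 1/B\<close>. The line \<open>Q \<Omega>\<^sub>1\<close> is the set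
  \<open>x : z = A : B\<close> and the line \<open>R \<Omega>\<^sub>2\<close> is the set \<open>x : y = A : C\<close>, hence they meet in
  \<open>A : C : B\<close> (\<open>first_brocard_vertex_eq_bary\<close>).

  For a triangle of the family, with \<open>P\<close> the image of the unit vector at angle \<open>\<theta>\<close>, the squared
  side opposite to \<open>P\<close> is an affine function of \<open>cos (2 \<theta>)\<close>, and the sum of the three is
  constant. In the point \<open>A : C : B\<close> the constant parts of the weights average
  the vertices to the centroid, which is the origin. The remaining parts sit on the vertices with
  those of \<open>Q\<close> and \<open>R\<close> exchanged, and therefore only the harmonic of angle \<open>- \<theta>\<close> survives the sum over the
  three vertices. So the
  vertex of the Brocard triangle is \<open>- k\<close> times the reflection of \<open>P\<close> in the
  \<open>x\<close>-axis, where \<open>k = (a\<^sup>2 - b\<^sup>2) / (2 (a\<^sup>2 + b\<^sup>2))\<close> (\<open>bary_poncelet\<close>). As \<open>P\<close> runs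
  through the outer ellipse, this point runs through the outer ellipse scaled by \<open>k\<close>, and
  \<open>k < 1/2\<close> puts it inside the caustic.\<close>

section \<open>Angles and orientation in the plane\<close>

definition cross2 :: "real^2 \<Rightarrow> real^2 \<Rightarrow> real" where
  "cross2 u v = u $ 1 * v $ 2 - u $ 2 * v $ 1"

lemma inner_vec2: "u \<bullet> v = u $ 1 * v $ 1 + u $ 2 * v $ 2" for u v :: "real^2"
  by (simp add: inner_vec_def sum_2)

lemma vec2_eq_iff: "u = v \<longleftrightarrow> u $ 1 = v $ 1 \<and> u $ 2 = v $ 2" for u v :: "real^2"
  by (simp add: vec_eq_iff forall_2)

lemma lagrange_identity2: "(norm u * norm v)\<^sup>2 = (u \<bullet> v)\<^sup>2 + (cross2 u v)\<^sup>2"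
  unfolding power_mult_distrib power2_norm_eq_inner inner_vec2 cross2_def
  by (simp add: algebra_simps power2_eq_square)

lemma cross2_scaleR:
  "cross2 (c *\<^sub>R u) v = c * cross2 u v" "cross2 u (c *\<^sub>R v) = c * cross2 u v"
  by (simp_all add: cross2_def algebra_simps)

lemma collinear_iff_cross2:
  "collinear {P, Q, R} \<longleftrightarrow> cross2 (Q - P) (R - P) = 0"
proof -
  have "collinear {P, Q, R} \<longleftrightarrow> collinear {0, Q - P, R - P}"
    using collinear_3[of Q P R] by (simp add: insert_commute)
  also have "\<dots> \<longleftrightarrow> \<bar>(Q - P) \<bullet> (R - P)\<bar> = norm (Q - P) * norm (R - P)"
    by (simp add: norm_cauchy_schwarz_equal)
  also have "\<dots> \<longleftrightarrow> ((Q - P) \<bullet> (R - P))\<^sup>2 = (norm (Q - P) * norm (R - P))\<^sup>2"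
    by (metis abs_mult abs_norm_cancel power2_eq_iff_nonneg abs_ge_zero power2_abs)
  finally show ?thesis
    by (simp add: lagrange_identity2)
qed

text \<open>The angle is the inverse cotangent of the ratio of inner to cross product. In this form, equality
  of angles becomes equality of these ratios, which are rational in barycentric coordinates.\<close>
lemma angle_eq_arctan:
  assumes "cross2 (A - B) (C - B) \<noteq> 0"
  shows "angle A B C = pi/2 - arctan (((A - B) \<bullet> (C - B)) / \<bar>cross2 (A - B) (C - B)\<bar>)"
proof -
  define d where "d = (A - B) \<bullet> (C - B)"
  define s where "s = \<bar>cross2 (A - B) (C - B)\<bar>"
  have s: "s > 0" using assms by (simp add: s_def)
  have "norm (A - B) * norm (C - B) = sqrt (d\<^sup>2 + s\<^sup>2)"
    using lagrange_identity2[of "A - B" "C - B"]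
    by (simp add: d_def s_def real_sqrt_unique)
  moreover have "1 + (d / s)\<^sup>2 = (d\<^sup>2 + s\<^sup>2) / s\<^sup>2"
    using s by (simp add: field_simps)
  then have "sqrt (1 + (d / s)\<^sup>2) = sqrt (d\<^sup>2 + s\<^sup>2) / s"
    using s by (simp add: real_sqrt_divide)
  ultimately have "d / (norm (A - B) * norm (C - B)) = sin (arctan (d / s))"
    using s by (simp add: sin_arctan)
  also have "\<dots> = cos (pi/2 - arctan (d / s))"
    by (simp add: cos_diff)
  finally have "angle A B C = arccos (cos (pi/2 - arctan (d / s)))"
    by (simp add: angle_def d_def)
  also have "\<dots> = pi/2 - arctan (d / s)"
    using arctan_bounded[of "d/s"] by (intro arccos_cos) auto
  finally show ?thesis by (simp add: d_def s_def)
qed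

lemma cross2_rotate: "cross2 (R - Q) (P - Q) = cross2 (Q - P) (R - P)"
  by (simp add: cross2_def algebra_simps)

section \<open>Brocard points in barycentric coordinates\<close>

text \<open>The cotangent of the angle at \<open>P\<close> is written with the symmetric summand
  \<open>(PQ\<^sup>2 + QR\<^sup>2 + RP\<^sup>2) / 2\<close> split off, because that summand and the denominator do not change when
  the vertices are permuted cyclically.\<close>
lemma brocard_angle:
  fixes P Q R :: "real^2"
  assumes "\<not> collinear {P, Q, R}" "z > 0" "x + y + z = 1"
  shows "angle (x *\<^sub>R P + y *\<^sub>R Q + z *\<^sub>R R) P Q =
    pi/2 - arctan ((y / z * (dist P Q)\<^sup>2 - (dist Q R)\<^sup>2 +
       ((dist P Q)\<^sup>2 + (dist Q R)\<^sup>2 + (dist R P)\<^sup>2) / 2) / \<bar>cross2 (Q - P) (R - P)\<bar>)"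
proof -
  define W where "W = x *\<^sub>R P + y *\<^sub>R Q + z *\<^sub>R R"
  define S where "S = cross2 (Q - P) (R - P)"
  have S: "S \<noteq> 0" using assms(1) by (simp add: collinear_iff_cross2 S_def)
  have x: "x = 1 - y - z" using assms by simp
  have WP: "W - P = y *\<^sub>R (Q - P) + z *\<^sub>R (R - P)"
    by (simp add: W_def x algebra_simps)
  have c: "cross2 (W - P) (Q - P) = - (z * S)"
    unfolding WP by (simp add: S_def cross2_def algebra_simps)
  have d: "(W - P) \<bullet> (Q - P) = y * (dist P Q)\<^sup>2 + z * ((R - P) \<bullet> (Q - P))"
    unfolding WP
    by (simp add: dist_norm norm_minus_commute[of P] power2_norm_eq_inner inner_add_left)
  have "(R - P) \<bullet> (Q - P) = ((dist P Q)\<^sup>2 + (dist Q R)\<^sup>2 + (dist R P)\<^sup>2) / 2 - (dist Q R)\<^sup>2"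
    by (simp add: dist_norm power2_norm_eq_inner inner_vec2 field_simps)
  with d have d: "(W - P) \<bullet> (Q - P) / z = y / z * (dist P Q)\<^sup>2 - (dist Q R)\<^sup>2 +
       ((dist P Q)\<^sup>2 + (dist Q R)\<^sup>2 + (dist R P)\<^sup>2) / 2"
    using \<open>z > 0\<close> by (simp add: field_simps)
  have quot: "(W - P) \<bullet> (Q - P) / \<bar>cross2 (W - P) (Q - P)\<bar> = ((W - P) \<bullet> (Q - P) / z) / \<bar>S\<bar>"
    using \<open>z > 0\<close> by (simp add: c abs_mult)
  have "cross2 (W - P) (Q - P) \<noteq> 0"
    using S \<open>z > 0\<close> by (simp add: c)
  from angle_eq_arctan[OF this] show ?thesis
    unfolding quot d unfolding W_def S_def .
qed

text \<open>The point with homogeneous barycentric coordinates \<open>x : y : z\<close>; a weight sum of \<open>0\<close> gives the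
  origin as a default.\<close>
definition bary :: "real \<Rightarrow> real \<Rightarrow> real \<Rightarrow> real^2 \<Rightarrow> real^2 \<Rightarrow> real^2 \<Rightarrow> real^2" where
  "bary x y z P Q R = (1 / (x + y + z)) *\<^sub>R (x *\<^sub>R P + y *\<^sub>R Q + z *\<^sub>R R)"

lemma bary_rotate: "bary y z x Q R P = bary x y z P Q R"
  by (simp add: bary_def add_ac)

text \<open>A common shift of three positive factors moves their product strictly monotonically. This is
  what makes the Brocard point unique.\<close>
lemma equal_shift_zero:
  fixes p :: real
  assumes "(p + A) * (p + B) * (p + C) = A * B * C" "p + A > 0" "p + B > 0" "p + C > 0"
    "A > 0" "B > 0" "C > 0"
  shows "p = 0"
proof (rule ccontr)
  assume "p \<noteq> 0"
  then consider "p > 0" | "p < 0" by linarith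
  then show False
  proof cases
    case 1
    then have "A * B * C < (p + A) * (p + B) * (p + C)"
      using assms by (intro mult_strict_mono) auto
    with assms show False by simp
  next
    case 2
    then have "(p + A) * (p + B) * (p + C) < A * B * C"
      using assms by (intro mult_strict_mono) auto
    with assms show False by simp
  qed
qed

text \<open>By \<open>brocard_angle\<close>, equality of the three angles means that \<open>y/z PQ\<^sup>2\<close>, \<open>z/x QR\<^sup>2\<close>,
  \<open>x/y RP\<^sup>2\<close> exceed \<open>QR\<^sup>2\<close>, \<open>RP\<^sup>2\<close>, \<open>PQ\<^sup>2\<close> by the same amount \<open>p\<close>. Both triples have
  the same product, so \<open>p\<close> must vanish.\<close>
lemma brocard_angles_equal_iff:
  fixes P Q R :: "real^2"
  assumes nc: "\<not> collinear {P, Q, R}" and pos: "x > 0" "y > 0" "z > 0" and sum: "x + y + z = 1"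
  defines "W \<equiv> x *\<^sub>R P + y *\<^sub>R Q + z *\<^sub>R R"
  shows "angle W P Q = angle W Q R \<and> angle W Q R = angle W R P \<longleftrightarrow>
    y * (dist P Q)\<^sup>2 = z * (dist Q R)\<^sup>2 \<and> z * (dist Q R)\<^sup>2 = x * (dist R P)\<^sup>2"
proof -
  define A where "A = (dist Q R)\<^sup>2"
  define B where "B = (dist R P)\<^sup>2"
  define C where "C = (dist P Q)\<^sup>2"
  have "P \<noteq> Q" "Q \<noteq> R" "R \<noteq> P" using nc by (auto simp: insert_commute)
  then have ABC: "A > 0" "B > 0" "C > 0" by (auto simp: A_def B_def C_def)
  define S where "S = \<bar>cross2 (Q - P) (R - P)\<bar>"
  have S: "S > 0" using nc by (simp add: collinear_iff_cross2 S_def)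
  have nc': "\<not> collinear {Q, R, P}" "\<not> collinear {R, P, Q}"
    using nc by (simp_all add: insert_commute)
  have W: "W = y *\<^sub>R Q + z *\<^sub>R R + x *\<^sub>R P" "W = z *\<^sub>R R + x *\<^sub>R P + y *\<^sub>R Q"
    by (simp_all add: W_def)
  define f where "f t = pi/2 - arctan ((t + (A + B + C) / 2) / S)" for t
  have f: "f t = f u \<longleftrightarrow> t = u" for t u
    using S by (simp add: f_def arctan_eq_iff)
  have "angle W P Q = f (y / z * C - A)"
    using brocard_angle[OF nc, of z x y] pos sum
    by (simp add: f_def W_def A_def B_def C_def S_def algebra_simps)
  moreover have "angle W Q R = f (z / x * A - B)"
    using brocard_angle[OF nc'(1), of x y z] pos sum
    by (simp add: f_def W(1) A_def B_def C_def S_def cross2_rotate algebra_simps)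
  moreover have "angle W R P = f (x / y * B - C)"
    using brocard_angle[OF nc'(2), of y z x] pos sum
    by (simp add: f_def W(2) A_def B_def C_def S_def cross2_rotate algebra_simps)
  ultimately have *: "angle W P Q = angle W Q R \<and> angle W Q R = angle W R P \<longleftrightarrow>
     y / z * C - A = z / x * A - B \<and> z / x * A - B = x / y * B - C"
    by (simp add: f)
  also have "\<dots> \<longleftrightarrow> y * C = z * A \<and> z * A = x * B"
  proof
    assume eq: "y / z * C - A = z / x * A - B \<and> z / x * A - B = x / y * B - C"
    define p where "p = y / z * C - A"
    have p: "p + A = y / z * C" "p + B = z / x * A" "p + C = x / y * B"
      using eq by (simp_all add: p_def)
    have "p = 0"
    proof (rule equal_shift_zero)
      show "(p + A) * (p + B) * (p + C) = A * B * C"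
        unfolding p using pos by simp
    qed (use pos ABC p in simp_all)
    then show "y * C = z * A \<and> z * A = x * B"
      using p pos by (simp add: field_simps)
  next
    assume "y * C = z * A \<and> z * A = x * B"
    then have "y / z * C = A" "z / x * A = B" "x / y * B = C"
      using pos by (simp_all add: field_simps)
    then show "y / z * C - A = z / x * A - B \<and> z / x * A - B = x / y * B - C"
      by simp
  qed
  finally show ?thesis by (simp add: A_def B_def C_def)
qed

lemma brocard_point1_eq_bary:
  assumes nc: "\<not> collinear {P, Q, R}"
  shows "brocard_point1 P Q R =
    bary (inverse ((dist R P)\<^sup>2)) (inverse ((dist P Q)\<^sup>2)) (inverse ((dist Q R)\<^sup>2)) P Q R"
proof -
  define A where "A = (dist Q R)\<^sup>2"
  define B where "B = (dist R P)\<^sup>2"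
  define C where "C = (dist P Q)\<^sup>2"
  have "P \<noteq> Q" "Q \<noteq> R" "R \<noteq> P" using nc by (auto simp: insert_commute)
  then have ABC: "A > 0" "B > 0" "C > 0" by (auto simp: A_def B_def C_def)
  define s where "s = inverse B + inverse C + inverse A"
  have s: "s > 0" using ABC by (simp add: s_def add_pos_pos)
  define x y z where "x = inverse B / s" and "y = inverse C / s" and "z = inverse A / s"
  have pos: "x > 0" "y > 0" "z > 0" using ABC s by (simp_all add: x_def y_def z_def)
  have sum: "x + y + z = 1"
    using s by (simp add: x_def y_def z_def s_def flip: add_divide_distrib)
  have W: "bary (inverse B) (inverse C) (inverse A) P Q R = x *\<^sub>R P + y *\<^sub>R Q + z *\<^sub>R R"
    by (simp add: bary_def x_def y_def z_def s_def scaleR_add_right)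
  have hull: "interior (convex hull {P, Q, R}) =
      {v. \<exists>x y z. 0 < x \<and> 0 < y \<and> 0 < z \<and> x + y + z = 1 \<and> x *\<^sub>R P + y *\<^sub>R Q + z *\<^sub>R R = v}"
    using nc by (intro interior_convex_hull_3_minimal) simp_all
  show ?thesis
    unfolding brocard_point1_def A_def[symmetric] B_def[symmetric] C_def[symmetric] W
  proof (rule the_equality, goal_cases)
    case 1
    have "y * C = z * A \<and> z * A = x * B"
      using ABC by (simp add: x_def y_def z_def)
    then show ?case
      using brocard_angles_equal_iff[OF nc pos sum] pos sum unfolding hull
      by (auto simp: A_def B_def C_def)
  next
    case (2 V)
    then obtain x' y' z' where pos': "x' > 0" "y' > 0" "z' > 0" and sum': "x' + y' + z' = 1"
      and V: "V = x' *\<^sub>R P + y' *\<^sub>R Q + z' *\<^sub>R R"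
      unfolding hull by blast
    from 2 have "y' * C = z' * A \<and> z' * A = x' * B"
      using brocard_angles_equal_iff[OF nc pos' sum']
      unfolding V A_def B_def C_def by blast
    then have x': "x' = z' * A * inverse B" and y': "y' = z' * A * inverse C"
      and z': "z' = z' * A * inverse A"
      using ABC by (auto simp: field_simps)
    have "z' * A * s = z' * A * inverse B + z' * A * inverse C + z' * A * inverse A"
      by (simp add: s_def distrib_left)
    also have "\<dots> = 1"
      by (simp only: x'[symmetric] y'[symmetric] z'[symmetric] sum')
    finally have "z' * A * s = 1" .
    then have zA: "z' * A = 1 / s" using s by (simp add: field_simps)
    have "x' = x" "y' = y" "z' = z"
      using x' y' z' unfolding zA x_def y_def z_def by simp_all
    then show ?case by (simp add: V)
  qed
qed

lemma brocard_point1_rotate: "brocard_point1 Q R P = brocard_point1 P Q R"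
proof -
  have hull: "{Q, R, P} = {P, Q, R}" by auto
  show ?thesis
    unfolding brocard_point1_def hull by (intro arg_cong[where f = The] ext) auto
qed

lemma brocard_point2_eq_point1: "brocard_point2 P Q R = brocard_point1 Q P R"
proof -
  have hull: "{Q, P, R} = {P, Q, R}" by auto
  show ?thesis
    unfolding brocard_point1_def brocard_point2_def hull
    by (intro arg_cong[where f = The] ext) auto
qed

lemma lines_meet_eqI:
  assumes "X \<in> affine hull {A, B}" "X \<in> affine hull {C, D}" "cross2 (B - A) (D - C) \<noteq> 0"
  shows "lines_meet A B C D = X"
proof -
  have "Y = X" if Y: "Y \<in> affine hull {A, B}" "Y \<in> affine hull {C, D}" for Y
  proof -
    from assms(1,2) obtain s t where X: "X = A + s *\<^sub>R (B - A)" "X = C + t *\<^sub>R (D - C)"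
      unfolding affine_hull_2_alt by blast
    from Y obtain s' t' where Y: "Y = A + s' *\<^sub>R (B - A)" "Y = C + t' *\<^sub>R (D - C)"
      unfolding affine_hull_2_alt by blast
    have "Y - X = (s' - s) *\<^sub>R (B - A)"
      unfolding X(1) Y(1) by (simp add: algebra_simps)
    then have "cross2 (Y - X) (D - C) = (s' - s) * cross2 (B - A) (D - C)"
      by (simp add: cross2_scaleR)
    moreover have "Y - X = (t' - t) *\<^sub>R (D - C)"
      unfolding X(2) Y(2) by (simp add: algebra_simps)
    then have "cross2 (Y - X) (D - C) = 0"
      by (simp add: cross2_scaleR) (simp add: cross2_def)
    ultimately have "(s' - s) * cross2 (B - A) (D - C) = 0" by simp
    with assms(3) have "s' = s" by simp
    then show ?thesis using X Y by simp
  qed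
  then have "affine hull {A, B} \<inter> affine hull {C, D} = {X}"
    using assms(1,2) by blast
  then show ?thesis by (simp add: lines_meet_def)
qed

lemma bary_diff2:
  assumes "x + y + z \<noteq> 0"
  shows "bary x y z P Q R - Q = (1 / (x + y + z)) *\<^sub>R (x *\<^sub>R (P - Q) + z *\<^sub>R (R - Q))"
proof -
  have "Q = (1 / (x + y + z)) *\<^sub>R ((x + y + z) *\<^sub>R Q)" using assms by simp
  then have "bary x y z P Q R - Q = (1 / (x + y + z)) *\<^sub>R
     (x *\<^sub>R P + y *\<^sub>R Q + z *\<^sub>R R - (x + y + z) *\<^sub>R Q)"
    unfolding bary_def by (metis scaleR_diff_right)
  then show ?thesis by (simp add: algebra_simps)
qed

lemma bary_on_cevian:
  assumes "x > 0" "y > 0" "z > 0" "y' > 0" "k > 0"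
  shows "bary x y z P Q R \<in> affine hull {Q, bary (k * x) y' (k * z) P Q R}"
proof -
  have n: "x + y + z > 0" "k * x + y' + k * z > 0" using assms by (simp_all add: add_pos_pos)
  have *: "bary x y z P Q R - Q =
      ((k * x + y' + k * z) / (k * (x + y + z))) *\<^sub>R (bary (k * x) y' (k * z) P Q R - Q)"
    using n assms
    by (simp add: bary_diff2 scaleR_add_right)
  show ?thesis
    unfolding affine_hull_2_alt by (rule range_eqI[where x = "(k * x + y' + k * z) / (k * (x + y + z))"])
      (simp flip: *)
qed

text \<open>The line from \<open>Q\<close> through a point fixes the ratio of the outer two coordinates, and the line from
  \<open>R\<close> the ratio of the first two; the factors \<open>k\<close>, \<open>l\<close> and the coordinates \<open>y'\<close>, \<open>z'\<close> leave the lines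
  unchanged.\<close>
lemma lines_meet_cevians:
  assumes nc: "\<not> collinear {P, Q, R}" and pos: "x > 0" "y > 0" "z > 0"
    "y' > 0" "z' > 0" "k > 0" "l > 0"
  shows "lines_meet Q (bary (k * x) y' (k * z) P Q R) R (bary (l * x) (l * y) z' P Q R)
    = bary x y z P Q R"
proof (rule lines_meet_eqI)
  show "bary x y z P Q R \<in> affine hull {Q, bary (k * x) y' (k * z) P Q R}"
    using pos by (intro bary_on_cevian)
  have "bary y z x Q R P \<in> affine hull {R, bary (l * y) z' (l * x) Q R P}"
    using pos by (intro bary_on_cevian)
  then show "bary x y z P Q R \<in> affine hull {R, bary (l * x) (l * y) z' P Q R}"
    by (simp add: bary_rotate)
  have n: "k * x + y' + k * z > 0" "l * y + z' + l * x > 0" using pos by (simp_all add: add_pos_pos)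
  have 1: "bary (k * x) y' (k * z) P Q R - Q =
      (k / (k * x + y' + k * z)) *\<^sub>R (x *\<^sub>R (P - Q) + z *\<^sub>R (R - Q))"
    using n by (simp add: bary_diff2 scaleR_add_right)
  have "bary (l * x) (l * y) z' P Q R - R = bary (l * y) z' (l * x) Q R P - R"
    by (simp add: bary_rotate)
  also have "\<dots> = (l / (l * y + z' + l * x)) *\<^sub>R (y *\<^sub>R (Q - R) + x *\<^sub>R (P - R))"
    using n by (simp add: bary_diff2 scaleR_add_right)
  finally have 2: "bary (l * x) (l * y) z' P Q R - R =
      (l / (l * y + z' + l * x)) *\<^sub>R (y *\<^sub>R (Q - R) + x *\<^sub>R (P - R))" .
  have "cross2 (bary (k * x) y' (k * z) P Q R - Q) (bary (l * x) (l * y) z' P Q R - R)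
    = k / (k * x + y' + k * z) * (l / (l * y + z' + l * x)) *
      cross2 (x *\<^sub>R (P - Q) + z *\<^sub>R (R - Q)) (y *\<^sub>R (Q - R) + x *\<^sub>R (P - R))"
    unfolding 1 2 cross2_scaleR by (simp only: mult.assoc mult.left_commute)
  also have "cross2 (x *\<^sub>R (P - Q) + z *\<^sub>R (R - Q)) (y *\<^sub>R (Q - R) + x *\<^sub>R (P - R)) =
     x * (x + y + z) * cross2 (Q - P) (R - P)"
    by (simp add: cross2_def algebra_simps)
  finally show "cross2 (bary (k * x) y' (k * z) P Q R - Q) (bary (l * x) (l * y) z' P Q R - R) \<noteq> 0"
    using nc n pos by (simp add: collinear_iff_cross2)
qed

lemma first_brocard_vertex_eq_bary:
  assumes nc: "\<not> collinear {P, Q, R}"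
  shows "lines_meet Q (brocard_point1 P Q R) R (brocard_point2 P Q R) =
    bary ((dist Q R)\<^sup>2) ((dist P Q)\<^sup>2) ((dist R P)\<^sup>2) P Q R"
proof -
  define A where "A = (dist Q R)\<^sup>2"
  define B where "B = (dist R P)\<^sup>2"
  define C where "C = (dist P Q)\<^sup>2"
  have "P \<noteq> Q" "Q \<noteq> R" "R \<noteq> P" using nc by (auto simp: insert_commute)
  then have ABC: "A > 0" "B > 0" "C > 0" by (auto simp: A_def B_def C_def)
  have inv: "inverse (A * B) * A = inverse B" "inverse (A * B) * B = inverse A"
    "inverse (A * C) * A = inverse C" "inverse (A * C) * C = inverse A"
    using ABC by (simp_all add: field_simps)
  have 1: "brocard_point1 P Q R =
     bary (inverse (A * B) * A) (inverse C) (inverse (A * B) * B) P Q R"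
    unfolding inv by (simp add: brocard_point1_eq_bary[OF nc] A_def B_def C_def)
  have nc': "\<not> collinear {Q, P, R}" using nc by (simp add: insert_commute)
  have 2: "brocard_point2 P Q R =
     bary (inverse (A * C) * A) (inverse (A * C) * C) (inverse B) P Q R"
    unfolding inv brocard_point2_eq_point1 brocard_point1_eq_bary[OF nc']
    by (simp add: A_def B_def C_def bary_def dist_commute add_ac)
  show ?thesis
    using lines_meet_cevians[OF nc, of A C B "inverse C" "inverse B" "inverse (A*B)" "inverse (A*C)"] ABC
    unfolding 1 2 by (simp add: A_def B_def C_def)
qed

section \<open>Ellipses\<close>

definition stretch :: "real \<Rightarrow> real \<Rightarrow> real^2 \<Rightarrow> real^2" where
  "stretch p q X = vector [p * X $ 1, q * X $ 2]"

lemma stretch_nth [simp]: "stretch p q X $ 1 = p * X $ 1" "stretch p q X $ 2 = q * X $ 2"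
  by (simp_all add: stretch_def)

lemma stretch_image_ellipse:
  assumes "k \<noteq> 0" "l \<noteq> 0" "p \<noteq> 0" "q \<noteq> 0"
  shows "stretch k l ` ellipse p q = ellipse (k * p) (l * q)"
proof
  show "stretch k l ` ellipse p q \<subseteq> ellipse (k * p) (l * q)"
    using assms by (auto simp: ellipse_def power_mult_distrib)
  show "ellipse (k * p) (l * q) \<subseteq> stretch k l ` ellipse p q"
  proof
    fix X assume X: "X \<in> ellipse (k * p) (l * q)"
    have "X = stretch k l (stretch (1 / k) (1 / l) X)"
      using assms by (simp add: vec2_eq_iff)
    moreover have "stretch (1 / k) (1 / l) X \<in> ellipse p q"
      using X assms by (simp add: ellipse_def power_mult_distrib power_divide)
    ultimately show "X \<in> stretch k l ` ellipse p q" by blast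
  qed
qed

lemma homothetic_ellipse_scaled:
  assumes "k \<noteq> 0" "p \<noteq> 0" "q \<noteq> 0"
  shows "homothetic (ellipse (k * p) (k * q)) (ellipse p q)"
proof -
  have "ellipse (k * p) (k * q) = (\<lambda>X. 0 + k *\<^sub>R (X - 0)) ` ellipse p q"
    unfolding stretch_image_ellipse[OF assms(1,1,2,3), symmetric]
    by (intro image_cong) (simp_all add: vec2_eq_iff)
  then show ?thesis unfolding homothetic_def using assms(1) by blast
qed

text \<open>A connected set that avoids the ellipse and meets the region where the quadratic form is less
  than \<open>1\<close> cannot leave that region, by the intermediate value theorem, and the region is bounded.\<close>
lemma inside_ellipseI:
  assumes "p > 0" "q > 0" "(X $ 1)\<^sup>2 / p\<^sup>2 + (X $ 2)\<^sup>2 / q\<^sup>2 < 1"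
  shows "X \<in> inside (ellipse p q)"
proof -
  define f :: "real^2 \<Rightarrow> real" where "f Y = (Y $ 1)\<^sup>2 / p\<^sup>2 + (Y $ 2)\<^sup>2 / q\<^sup>2" for Y
  have E: "ellipse p q = {Y. f Y = 1}" by (simp add: ellipse_def f_def)
  define C where "C = connected_component_set (- ellipse p q) X"
  have fX: "f X < 1" using assms by (simp add: f_def)
  have XC: "X \<in> C" using fX by (simp add: C_def E)
  have C1: "f Y \<noteq> 1" if "Y \<in> C" for Y
    using that connected_component_subset[of "- ellipse p q" X] by (auto simp: C_def E)
  have cont: "continuous_on C f"
    unfolding f_def using assms by (intro continuous_intros) auto
  have "connected (f ` C)"
    by (rule connected_continuous_image[OF cont]) (simp add: C_def)
  have less: "f Y < 1" if "Y \<in> C" for Y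
  proof (rule ccontr)
    assume "\<not> f Y < 1"
    then have "1 \<in> f ` C"
      using connectedD_interval[OF \<open>connected (f ` C)\<close>, of "f X" "f Y" 1] XC that fX by simp
    then show False using C1 by auto
  qed
  have "bounded C"
  proof (rule boundedI)
    fix Y assume "Y \<in> C"
    have "(Y $ 1)\<^sup>2 / p\<^sup>2 \<ge> 0" "(Y $ 2)\<^sup>2 / q\<^sup>2 \<ge> 0" by auto
    with less[OF \<open>Y \<in> C\<close>] have "(Y $ 1)\<^sup>2 / p\<^sup>2 < 1" "(Y $ 2)\<^sup>2 / q\<^sup>2 < 1"
      unfolding f_def by linarith+
    then have "(Y $ 1)\<^sup>2 \<le> p\<^sup>2" "(Y $ 2)\<^sup>2 \<le> q\<^sup>2"
      using assms by simp_all
    then have "\<bar>Y $ 1\<bar> \<le> p" "\<bar>Y $ 2\<bar> \<le> q"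
      using assms by (simp_all add: abs_le_square_iff[symmetric])
    moreover have "norm Y \<le> \<bar>Y $ 1\<bar> + \<bar>Y $ 2\<bar>"
      using norm_le_l1_cart[of Y] by (simp add: sum_2)
    ultimately show "norm Y \<le> p + q" by linarith
  qed
  then show ?thesis
    using fX by (simp add: inside_def C_def E)
qed

section \<open>Triangles inscribed in an ellipse and circumscribed about its half\<close>

text \<open>The chord meets the smaller ellipse in a set that is symmetric about the midpoint of the chord,
  so a single point of intersection can only be the midpoint.\<close>
lemma tangent_chord_iff:
  fixes u v :: "real^2"
  assumes ab: "a \<noteq> 0" "b \<noteq> 0" and u: "u \<bullet> u = 1" and v: "v \<bullet> v = 1"
  shows "tangent_line (stretch a b u) (stretch a b v) (ellipse (a/2) (b/2)) \<longleftrightarrow> u \<bullet> v = - 1/2"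
proof -
  define L where "L t = stretch a b u + t *\<^sub>R (stretch a b v - stretch a b u)" for t
  define c where "c = u \<bullet> v"
  have hull: "affine hull {stretch a b u, stretch a b v} = range L"
    by (simp add: affine_hull_2_alt L_def)
  have L: "L t \<in> ellipse (a/2) (b/2) \<longleftrightarrow> 2 * (1 - c) * (2 * t - 1)\<^sup>2 = - 1 - 2 * c" for t
  proof -
    have "L t = stretch a b (u + t *\<^sub>R (v - u))"
      by (simp add: L_def vec2_eq_iff algebra_simps)
    moreover have "stretch a b w \<in> ellipse (a/2) (b/2) \<longleftrightarrow> 4 * (w \<bullet> w) = 1" for w
      using ab by (simp add: ellipse_def inner_vec2 power2_eq_square algebra_simps)
    ultimately have "L t \<in> ellipse (a/2) (b/2) \<longleftrightarrow>
        4 * ((u + t *\<^sub>R (v - u)) \<bullet> (u + t *\<^sub>R (v - u))) = 1"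
      by simp
    also have "(u + t *\<^sub>R (v - u)) \<bullet> (u + t *\<^sub>R (v - u)) = 1 - 2 * t * (1 - c) + t\<^sup>2 * (2 - 2 * c)"
      using u v by (simp add: c_def inner_commute[of v u] power2_eq_square
        inner_add_left inner_add_right inner_diff_left inner_diff_right algebra_simps)
    also have "4 * \<dots> = 1 \<longleftrightarrow> 2 * (1 - c) * (2 * t - 1)\<^sup>2 = - 1 - 2 * c"
      by (simp add: algebra_simps power2_eq_square)
    finally show ?thesis .
  qed
  show ?thesis
  proof
    assume "tangent_line (stretch a b u) (stretch a b v) (ellipse (a/2) (b/2))"
    then obtain X where ne: "stretch a b u \<noteq> stretch a b v"
      and X: "range L \<inter> ellipse (a/2) (b/2) = {X}"
      unfolding tangent_line_def hull by blast
    then have "X \<in> range L" and XE: "X \<in> ellipse (a/2) (b/2)" by blast+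
    then obtain t where t: "X = L t" by blast
    \<comment> \<open>Reflection in the midpoint of the chord preserves the intersection.\<close>
    have "L (1 - t) \<in> ellipse (a/2) (b/2)"
      using XE unfolding t L by (simp add: power2_eq_square algebra_simps)
    then have "L (1 - t) \<in> range L \<inter> ellipse (a/2) (b/2)" by simp
    then have "L (1 - t) = L t" unfolding X t by simp
    with ne have "t = 1/2" by (simp add: L_def)
    with XE show "u \<bullet> v = - 1/2" unfolding t L by (simp add: c_def)
  next
    assume "u \<bullet> v = - 1/2"
    then have c: "c = - 1/2" by (simp add: c_def)
    have iff: "L t \<in> ellipse (a/2) (b/2) \<longleftrightarrow> t = 1/2" for t
      unfolding L c by auto
    have "range L \<inter> ellipse (a/2) (b/2) = {L (1/2)}"
    proof (intro equalityI subsetI)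
      fix Y assume "Y \<in> range L \<inter> ellipse (a/2) (b/2)"
      then obtain t where Y: "Y = L t" "L t \<in> ellipse (a/2) (b/2)" by (elim IntE rangeE) simp
      then have "t = 1/2" by (simp only: iff)
      with Y show "Y \<in> {L (1/2)}" by simp
    qed (simp add: iff)
    moreover have "stretch a b u \<noteq> stretch a b v"
    proof
      assume "stretch a b u = stretch a b v"
      then have "u = v" using ab by (simp add: vec2_eq_iff)
      with u c show False by (simp add: c_def)
    qed
    ultimately show "tangent_line (stretch a b u) (stretch a b v) (ellipse (a/2) (b/2))"
      unfolding tangent_line_def hull by blast
  qed
qed

lemma in_ellipse_stretchE:
  assumes "P \<in> ellipse a b" "a \<noteq> 0" "b \<noteq> 0"
  obtains u where "P = stretch a b u" "u \<bullet> u = 1"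
proof
  show "P = stretch a b (stretch (1/a) (1/b) P)" using assms by (simp add: vec2_eq_iff)
  show "stretch (1/a) (1/b) P \<bullet> stretch (1/a) (1/b) P = 1"
    using assms by (simp add: inner_vec2 ellipse_def power2_eq_square)
qed

text \<open>For \<open>e = \<plusminus> sqrt 3 / 2\<close> this is the rotation by \<open>\<plusminus> 120\<close> degrees. Keeping \<open>e\<close> as a parameter treats
  both orientations of a triangle at once, with \<open>e\<^sup>2 = 3/4\<close> as the only relation.\<close>
definition turn :: "real \<Rightarrow> real^2 \<Rightarrow> real^2" where
  "turn e u = vector [- (u $ 1) / 2 - e * u $ 2, - (u $ 2) / 2 + e * u $ 1]"

lemma turn_nth [simp]: "turn e u $ 1 = - (u $ 1) / 2 - e * u $ 2"
  "turn e u $ 2 = - (u $ 2) / 2 + e * u $ 1"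
  by (simp_all add: turn_def)

lemma turn_inner:
  assumes "u \<bullet> u = 1" "e\<^sup>2 = 3/4"
  shows "turn e u \<bullet> turn e u = 1" "u \<bullet> turn e u = - 1/2" "turn e u \<bullet> turn (- e) u = - 1/2"
proof -
  have "turn e u \<bullet> turn e u = (1/4 + e\<^sup>2) * (u \<bullet> u)" "u \<bullet> turn e u = - (u \<bullet> u) / 2"
    "turn e u \<bullet> turn (- e) u = (1/4 - e\<^sup>2) * (u \<bullet> u)"
    by (simp_all add: inner_vec2 field_simps power2_eq_square)
  then show "turn e u \<bullet> turn e u = 1" "u \<bullet> turn e u = - 1/2" "turn e u \<bullet> turn (- e) u = - 1/2"
    using assms by simp_all
qed

text \<open>The three vectors sum to \<open>0\<close>, since the square of their sum is \<open>3 - 6/2\<close>. The sine of the angle from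
  \<open>u\<close> to \<open>v\<close> serves as \<open>e\<close>.\<close>
lemma unit_vectors_120:
  fixes u v w :: "real^2"
  assumes "u \<bullet> u = 1" "v \<bullet> v = 1" "w \<bullet> w = 1"
    "u \<bullet> v = - 1/2" "v \<bullet> w = - 1/2" "w \<bullet> u = - 1/2"
  obtains e where "e\<^sup>2 = 3/4" "v = turn e u" "w = turn (- e) u"
proof
  define e where "e = cross2 u v"
  have "(u + v + w) \<bullet> (u + v + w) = 0"
    using assms by (simp add: inner_add_left inner_add_right inner_commute)
  then have "u + v + w = 0" by simp
  then have w: "w = - u - v" by (simp add: add_eq_0_iff)
  show "e\<^sup>2 = 3/4"
    using lagrange_identity2[of u v] assms
    by (simp add: e_def power_mult_distrib power2_norm_eq_inner power_divide)
  have "v = (u \<bullet> u) *\<^sub>R v" using assms by simp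
  also have "\<dots> = vector [(u \<bullet> v) * u $ 1 - e * u $ 2, (u \<bullet> v) * u $ 2 + e * u $ 1]"
    by (simp add: vec2_eq_iff inner_vec2 e_def cross2_def algebra_simps)
  finally show v: "v = turn e u" using assms by (simp add: turn_def)
  show "w = turn (- e) u" unfolding w v by (simp add: vec2_eq_iff)
qed

lemma poncelet_triangleE:
  assumes "inscribed_triangle P Q R (ellipse a b)"
    "circumscribed_triangle P Q R (ellipse (a/2) (b/2))" and ab: "a \<noteq> 0" "b \<noteq> 0"
  obtains u e where "u \<bullet> u = 1" "e\<^sup>2 = 3/4"
    "P = stretch a b u" "Q = stretch a b (turn e u)" "R = stretch a b (turn (- e) u)"
proof -
  have mem: "P \<in> ellipse a b" "Q \<in> ellipse a b" "R \<in> ellipse a b"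
    using assms(1) by (auto simp: inscribed_triangle_def)
  obtain u where u: "P = stretch a b u" "u \<bullet> u = 1" using in_ellipse_stretchE[OF mem(1) ab] .
  obtain v where v: "Q = stretch a b v" "v \<bullet> v = 1" using in_ellipse_stretchE[OF mem(2) ab] .
  obtain w where w: "R = stretch a b w" "w \<bullet> w = 1" using in_ellipse_stretchE[OF mem(3) ab] .
  have "u \<bullet> v = - 1/2" "v \<bullet> w = - 1/2" "w \<bullet> u = - 1/2"
    using assms(2) tangent_chord_iff[OF ab] u v w unfolding circumscribed_triangle_def by blast+
  then obtain e where "e\<^sup>2 = 3/4" "v = turn e u" "w = turn (- e) u"
    using unit_vectors_120[OF u(2) v(2) w(2)] by blast
  then show thesis using that u v w by blast
qed

text \<open>Since the starting point is arbitrary, the locus is the whole image of the outer ellipse and not just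
  a part of it.\<close>
lemma poncelet_triangle_exists:
  assumes P: "P \<in> ellipse a b" and ab: "a \<noteq> 0" "b \<noteq> 0"
  obtains Q R where "inscribed_triangle P Q R (ellipse a b)"
    "circumscribed_triangle P Q R (ellipse (a/2) (b/2))"
proof -
  obtain u where u: "P = stretch a b u" "u \<bullet> u = 1" using in_ellipse_stretchE[OF P ab] .
  define e :: real where "e = sqrt (3/4)"
  have e: "e\<^sup>2 = 3/4" by (simp add: e_def)
  then have e': "(- e)\<^sup>2 = 3/4" by simp
  define Q R where "Q = stretch a b (turn e u)" and "R = stretch a b (turn (- e) u)"
  note t = turn_inner[OF u(2) e] turn_inner[OF u(2) e']
  have mem: "stretch a b v \<in> ellipse a b" if "v \<bullet> v = 1" for v
    using that ab by (simp add: ellipse_def inner_vec2 power2_eq_square)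
  have "cross2 (Q - P) (R - P) = 3 * e * a * b * (u \<bullet> u)"
    by (simp add: cross2_def Q_def R_def u(1) inner_vec2 field_simps power2_eq_square)
  then have nc: "\<not> collinear {P, Q, R}"
    using ab u e by (auto simp: collinear_iff_cross2)
  have "inscribed_triangle P Q R (ellipse a b)"
    using nc P mem[OF t(1)] mem[OF t(4)] by (simp add: inscribed_triangle_def Q_def R_def)
  moreover have "circumscribed_triangle P Q R (ellipse (a/2) (b/2))"
    using nc t u(2) unfolding circumscribed_triangle_def u(1) Q_def R_def
    by (simp add: tangent_chord_iff[OF ab] inner_commute[of "turn (- e) u" u])
  ultimately show thesis using that by blast
qed

section \<open>The first Brocard triangle over the family\<close>

text \<open>With \<open>A = QR\<^sup>2\<close>, \<open>B = RP\<^sup>2\<close>, \<open>C = PQ\<^sup>2\<close>, the weighted sum is the image of a vector that splits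
  into a part along \<open>u\<close>, with factor \<open>A - (B + C)/2\<close>, and a part along the quarter turn of \<open>u\<close>,
  with factor \<open>e (C - B)\<close>. Both factors are proportional to \<open>a\<^sup>2 - b\<^sup>2\<close>, while the total weight is constant.\<close>
lemma bary_poncelet:
  assumes u: "u \<bullet> u = 1" and e: "e\<^sup>2 = 3/4" and ab: "a \<noteq> 0" "b \<noteq> 0"
  defines "P \<equiv> stretch a b u" and "Q \<equiv> stretch a b (turn e u)" and "R \<equiv> stretch a b (turn (- e) u)"
    and "k \<equiv> (a\<^sup>2 - b\<^sup>2) / (2 * (a\<^sup>2 + b\<^sup>2))"
  shows "bary ((dist Q R)\<^sup>2) ((dist P Q)\<^sup>2) ((dist R P)\<^sup>2) P Q R = stretch (- k) k P"
proof -
  define x y where "x = u $ 1" and "y = u $ 2"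
  have xy: "x\<^sup>2 + y\<^sup>2 = 1" using u by (simp add: x_def y_def inner_vec2 power2_eq_square)
  define A where "A = (dist Q R)\<^sup>2"
  define B where "B = (dist R P)\<^sup>2"
  define C where "C = (dist P Q)\<^sup>2"
  have d: "(dist V W)\<^sup>2 = (V $ 1 - W $ 1)\<^sup>2 + (V $ 2 - W $ 2)\<^sup>2" for V W :: "real^2"
    unfolding dist_norm power2_norm_eq_inner inner_vec2 by (simp add: power2_eq_square)
  have c: "P $ 1 = a * x" "P $ 2 = b * y" "Q $ 1 = a * (- x / 2 - e * y)" "Q $ 2 = b * (- y / 2 + e * x)"
    "R $ 1 = a * (- x / 2 + e * y)" "R $ 2 = b * (- y / 2 - e * x)"
    by (simp_all add: P_def Q_def R_def x_def y_def)
  have "A = 4 * e\<^sup>2 * (a\<^sup>2 * y\<^sup>2 + b\<^sup>2 * x\<^sup>2)"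
    unfolding A_def d c by (simp add: power2_eq_square algebra_simps)
  then have A: "A = 3 * (a\<^sup>2 * y\<^sup>2 + b\<^sup>2 * x\<^sup>2)" using e by simp
  have "B + C = a\<^sup>2 * (9/2 * x\<^sup>2 + 2 * e\<^sup>2 * y\<^sup>2) + b\<^sup>2 * (9/2 * y\<^sup>2 + 2 * e\<^sup>2 * x\<^sup>2)"
    unfolding B_def C_def d c by (simp add: power2_eq_square field_simps)
  then have BC: "B + C = a\<^sup>2 * (9/2 * x\<^sup>2 + 3/2 * y\<^sup>2) + b\<^sup>2 * (9/2 * y\<^sup>2 + 3/2 * x\<^sup>2)"
    using e by simp
  have CB: "C - B = 6 * e * x * y * (a\<^sup>2 - b\<^sup>2)"
    unfolding B_def C_def d c by (simp add: power2_eq_square field_simps)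
  have "A + (B + C) = 9/2 * (a\<^sup>2 + b\<^sup>2) * (x\<^sup>2 + y\<^sup>2)"
    unfolding A BC by (simp add: field_simps)
  then have S: "A + C + B = 9/2 * (a\<^sup>2 + b\<^sup>2)" using xy by simp
  have AB: "A - (B + C) / 2 = 9/4 * (a\<^sup>2 - b\<^sup>2) * (y\<^sup>2 - x\<^sup>2)"
    unfolding A BC by (simp add: field_simps)
  have "A * P $ 1 + C * Q $ 1 + B * R $ 1 = a * (x * (A - (B + C) / 2) - e * y * (C - B))"
    unfolding c by (simp add: algebra_simps add_divide_distrib)
  also have "\<dots> = a * x * (a\<^sup>2 - b\<^sup>2) * (9/4 * (y\<^sup>2 - x\<^sup>2) - 6 * e\<^sup>2 * y\<^sup>2)"
    unfolding AB CB by (simp add: algebra_simps power2_eq_square)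
  also have "9/4 * (y\<^sup>2 - x\<^sup>2) - 6 * e\<^sup>2 * y\<^sup>2 = - 9/4 * (x\<^sup>2 + y\<^sup>2)"
    unfolding e by (simp add: field_simps)
  finally have 1: "A * P $ 1 + C * Q $ 1 + B * R $ 1 = - 9/4 * (a\<^sup>2 - b\<^sup>2) * P $ 1"
    unfolding xy c by simp
  have "A * P $ 2 + C * Q $ 2 + B * R $ 2 = b * (y * (A - (B + C) / 2) + e * x * (C - B))"
    unfolding c by (simp add: algebra_simps add_divide_distrib)
  also have "\<dots> = b * y * (a\<^sup>2 - b\<^sup>2) * (9/4 * (y\<^sup>2 - x\<^sup>2) + 6 * e\<^sup>2 * x\<^sup>2)"
    unfolding AB CB by (simp add: algebra_simps power2_eq_square)
  also have "9/4 * (y\<^sup>2 - x\<^sup>2) + 6 * e\<^sup>2 * x\<^sup>2 = 9/4 * (x\<^sup>2 + y\<^sup>2)"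
    unfolding e by (simp add: field_simps)
  finally have 2: "A * P $ 2 + C * Q $ 2 + B * R $ 2 = 9/4 * (a\<^sup>2 - b\<^sup>2) * P $ 2"
    unfolding xy c by simp
  have "a\<^sup>2 + b\<^sup>2 \<noteq> 0" using ab by (simp add: sum_power2_eq_zero_iff)
  define n where "n = a\<^sup>2 + b\<^sup>2"
  define s where "s = 9/2 * n"
  have s: "s \<noteq> 0" "9/4 * (a\<^sup>2 - b\<^sup>2) = s * k"
    using \<open>a\<^sup>2 + b\<^sup>2 \<noteq> 0\<close> by (simp_all add: s_def k_def flip: n_def)
  have S': "A + C + B = s" using S by (simp add: s_def n_def)
  have "A * P $ 1 + C * Q $ 1 + B * R $ 1 = s * (- k * P $ 1)"
    using 1 s(2) by simp
  moreover have "A * P $ 2 + C * Q $ 2 + B * R $ 2 = s * (k * P $ 2)"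
    using 2 s(2) by simp
  ultimately have "bary A C B P Q R = stretch (- k) k P"
    using s(1) by (simp add: vec2_eq_iff bary_def S')
  then show ?thesis by (simp add: A_def B_def C_def)
qed

text \<open>Cyclic relabelling carries one vertex to the next, because the Brocard points and the
  conditions that define the family are invariant under it.\<close>
lemma first_brocard_triangle_poncelet:
  assumes tri: "inscribed_triangle P Q R (ellipse a b)"
    "circumscribed_triangle P Q R (ellipse (a/2) (b/2))" and ab: "a \<noteq> 0" "b \<noteq> 0"
  defines "k \<equiv> (a\<^sup>2 - b\<^sup>2) / (2 * (a\<^sup>2 + b\<^sup>2))"
  shows "first_brocard_triangle_vertices P Q R = stretch (- k) k ` {P, Q, R}"
proof -
  have vertex: "lines_meet Q (brocard_point1 P Q R) R (brocard_point2 P Q R) = stretch (- k) k P"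
    if tri: "inscribed_triangle P Q R (ellipse a b)" "circumscribed_triangle P Q R (ellipse (a/2) (b/2))"
    for P Q R
  proof -
    have "\<not> collinear {P, Q, R}" using tri by (simp add: inscribed_triangle_def)
    moreover obtain u e where "u \<bullet> u = 1" "e\<^sup>2 = 3/4"
      "P = stretch a b u" "Q = stretch a b (turn e u)" "R = stretch a b (turn (- e) u)"
      using poncelet_triangleE[OF tri ab] .
    ultimately show ?thesis
      using bary_poncelet[of u e a b] ab by (simp add: first_brocard_vertex_eq_bary k_def)
  qed
  have rotate: "inscribed_triangle Q R P E" "circumscribed_triangle Q R P C"
    if "inscribed_triangle P Q R E" "circumscribed_triangle P Q R C" for P Q R E C
  proof -
    have set: "{Q, R, P} = {P, Q, R}" by auto
    show "inscribed_triangle Q R P E" "circumscribed_triangle Q R P C"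
      using that unfolding inscribed_triangle_def circumscribed_triangle_def set by blast+
  qed
  note tri' = rotate[OF tri]
  have brocard: "brocard_point1 Q R P = brocard_point1 P Q R"
    "brocard_point1 R P Q = brocard_point1 P Q R"
    "brocard_point2 Q R P = brocard_point2 P Q R"
    "brocard_point2 R P Q = brocard_point2 P Q R"
    by (metis brocard_point1_rotate brocard_point2_eq_point1)+
  have "lines_meet R (brocard_point1 P Q R) P (brocard_point2 P Q R) = stretch (- k) k Q"
    using vertex[OF tri'] unfolding brocard .
  moreover have "lines_meet P (brocard_point1 P Q R) Q (brocard_point2 P Q R) = stretch (- k) k R"
    using vertex[OF rotate[OF tri']] unfolding brocard .
  ultimately show ?thesis
    using vertex[OF tri] by (simp add: first_brocard_triangle_vertices_def Let_def)
qed

lemma first_brocard_locus_poncelet: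
  assumes ab: "a \<noteq> 0" "b \<noteq> 0"
  defines "k \<equiv> (a\<^sup>2 - b\<^sup>2) / (2 * (a\<^sup>2 + b\<^sup>2))"
  shows "first_brocard_locus (ellipse a b) (ellipse (a/2) (b/2)) = stretch (- k) k ` ellipse a b"
proof
  show "first_brocard_locus (ellipse a b) (ellipse (a/2) (b/2)) \<subseteq> stretch (- k) k ` ellipse a b"
  proof
    fix X assume "X \<in> first_brocard_locus (ellipse a b) (ellipse (a/2) (b/2))"
    then obtain P Q R where tri: "inscribed_triangle P Q R (ellipse a b)"
      "circumscribed_triangle P Q R (ellipse (a/2) (b/2))"
      and X: "X \<in> first_brocard_triangle_vertices P Q R"
      unfolding first_brocard_locus_def by blast
    have "X \<in> stretch (- k) k ` {P, Q, R}"
      using X first_brocard_triangle_poncelet[OF tri ab] by (simp add: k_def)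
    then show "X \<in> stretch (- k) k ` ellipse a b"
      using tri(1) unfolding inscribed_triangle_def by blast
  qed
  show "stretch (- k) k ` ellipse a b \<subseteq> first_brocard_locus (ellipse a b) (ellipse (a/2) (b/2))"
  proof (rule image_subsetI)
    fix P assume "P \<in> ellipse a b"
    then obtain Q R where tri: "inscribed_triangle P Q R (ellipse a b)"
      "circumscribed_triangle P Q R (ellipse (a/2) (b/2))"
      using poncelet_triangle_exists ab by blast
    have "stretch (- k) k P \<in> first_brocard_triangle_vertices P Q R"
      using first_brocard_triangle_poncelet[OF tri ab] by (simp add: k_def)
    then show "stretch (- k) k P \<in> first_brocard_locus (ellipse a b) (ellipse (a/2) (b/2))"
      unfolding first_brocard_locus_def using tri by blast
  qed
qed

theorem proposition6:
  fixes a b a' b' :: real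
  assumes "a > b" and "b > 0"
    and "a' = a * (a\<^sup>2 - b\<^sup>2) / (2 * (a\<^sup>2 + b\<^sup>2))"
    and "b' = b * (a\<^sup>2 - b\<^sup>2) / (2 * (a\<^sup>2 + b\<^sup>2))"
  shows "a' > 0 \<and> b' > 0 \<and>
    first_brocard_locus (ellipse a b) (ellipse (a/2) (b/2)) = ellipse a' b' \<and>
    homothetic (ellipse a' b') (ellipse a b) \<and>
    homothetic (ellipse a' b') (ellipse (a/2) (b/2)) \<and>
    ellipse a' b' \<subseteq> inside (ellipse (a/2) (b/2))"
proof -
  define k where "k = (a\<^sup>2 - b\<^sup>2) / (2 * (a\<^sup>2 + b\<^sup>2))"
  have a: "a > 0" using assms by simp
  have "b\<^sup>2 < a\<^sup>2" using assms by (intro power_strict_mono) auto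
  moreover have "b\<^sup>2 > 0" using assms by simp
  moreover define n where "n = a\<^sup>2 + b\<^sup>2"
  ultimately have "n > 0" "a\<^sup>2 - b\<^sup>2 > 0" "a\<^sup>2 - b\<^sup>2 < n"
    by linarith+
  then have k: "k > 0" "2 * k < 1"
    by (simp_all add: k_def divide_less_eq flip: n_def)
  have a': "a' = k * a" "b' = k * b" using assms by (simp_all add: k_def)
  have "first_brocard_locus (ellipse a b) (ellipse (a/2) (b/2)) = stretch (- k) k ` ellipse a b"
    unfolding k_def using a \<open>b > 0\<close> by (intro first_brocard_locus_poncelet) auto
  also have "\<dots> = ellipse (- k * a) (k * b)"
    using a \<open>b > 0\<close> k by (intro stretch_image_ellipse) auto
  finally have "first_brocard_locus (ellipse a b) (ellipse (a/2) (b/2)) = ellipse (- k * a) (k * b)" .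
  then have "first_brocard_locus (ellipse a b) (ellipse (a/2) (b/2)) = ellipse a' b'"
    by (simp add: a' ellipse_def)
  moreover have "homothetic (ellipse a' b') (ellipse a b)"
    unfolding a' using homothetic_ellipse_scaled k a \<open>b > 0\<close> by simp
  moreover have "homothetic (ellipse a' b') (ellipse (a/2) (b/2))"
    using homothetic_ellipse_scaled[of "2 * k" "a/2" "b/2"] k a \<open>b > 0\<close> by (simp add: a')
  moreover have "ellipse a' b' \<subseteq> inside (ellipse (a/2) (b/2))"
  proof
    fix X assume "X \<in> ellipse a' b'"
    then have "((X $ 1)\<^sup>2 / a\<^sup>2 + (X $ 2)\<^sup>2 / b\<^sup>2) / k\<^sup>2 = 1"
      by (simp add: ellipse_def a' power_mult_distrib add_divide_distrib mult.commute)
    then have "(X $ 1)\<^sup>2 / a\<^sup>2 + (X $ 2)\<^sup>2 / b\<^sup>2 = k\<^sup>2"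
      using k by simp
    moreover have "(X $ 1)\<^sup>2 / (a/2)\<^sup>2 + (X $ 2)\<^sup>2 / (b/2)\<^sup>2 =
        4 * ((X $ 1)\<^sup>2 / a\<^sup>2 + (X $ 2)\<^sup>2 / b\<^sup>2)"
      by (simp add: power_divide algebra_simps)
    ultimately have "(X $ 1)\<^sup>2 / (a/2)\<^sup>2 + (X $ 2)\<^sup>2 / (b/2)\<^sup>2 = (2 * k)\<^sup>2"
      by (simp add: power_mult_distrib)
    also have "\<dots> < 1" using power_strict_mono[of "2 * k" 1 2] k by simp
    finally show "X \<in> inside (ellipse (a/2) (b/2))"
      using a \<open>b > 0\<close> by (intro inside_ellipseI) auto
  qed
  ultimately show ?thesis using k a \<open>b > 0\<close> by (simp add: a')
qed

end
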